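(* Let $\Omega\subset\mathbb R^3$ be a bounded connected Lipschitz domain, let $\Gamma_d\subset\partial\Omega$ be a nonempty relatively open set of positive surface measure, let $p,q\ge 2$ be finite, and let $\varphi^*\in \mathrm W^{1-1/p,p}(\Gamma_d;\mathbb R^3)$. Define $$\mathcal A_{\rm relax}=\Bigl\{(\varphi,\overline R)\in \mathrm W^{1,p}(\Omega;\mathbb R^3)\times \mathrm W^{1,q}(\Omega;\mathrm{SO}(3))\ \Big|\ \operatorname{Tr}_{\Gamma_d}\varphi=\varphi^*,\ \ \overline R^T\mathrm D\varphi\in\operatorname{Sym}^{+}(3)\text{ a.e.},\ \ \det \mathrm D\varphi>0\text{ a.e.}\Bigr\},$$ $$\mathcal A_{\rm pol}=\Bigl\{\varphi\in \mathrm W^{1,p}(\Omega;\mathbb R^3)\ \Big|\ \operatorname{Tr}_{\Gamma_d}\varphi=\varphi^*,\ \ \det \mathrm D\varphi>0\text{ a.e.},\ \ R:=\operatorname{polar}(\mathrm D\varphi)\in \mathrm W^{1,q}(\Omega;\mathrm{SO}(3))\Bigr\}.$$ Then $\varphi\mapsto(\varphi,R)$, with $R=\operatorname{polar}(\mathrm D\varphi)$, is a bijection from $\mathcal A_{\rm pol}$ onto $\mathcal A_{\rm relax}$, and for every corresponding pair $$R^T\mathrm D\varphi=\sqrt{(\mathrm D\varphi)^T\mathrm D\varphi}\in\operatorname{Sym}^{++}(3)\qquad\text{a.e. in }\Omega.$$ Moreover, let $W:\Omega\times\mathbb R^{3\times3}\times\mathbb R^{3\times3}\to(-\infty,+\infty]$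 be an energy density for which the integrals below are well defined, and set $$\mathcal I(\varphi,\overline R)=\int_\Omega W\bigl(x,\overline R^T\mathrm D\varphi,\overline R^T\operatorname{Curl}\overline R\bigr)\,\mathrm dx,\qquad \mathcal J(\varphi)=\int_\Omega W\Bigl(x,\sqrt{(\mathrm D\varphi)^T\mathrm D\varphi},R^T\operatorname{Curl}R\Bigr)\,\mathrm dx$$ for $(\varphi,\overline R)\in\mathcal A_{\rm relax}$ and $\varphi\in\mathcal A_{\rm pol}$ respectively. Then $\mathcal J(\varphi)=\mathcal I(\varphi,R)$ for every $\varphi\in\mathcal A_{\rm pol}$.
   Context: $\operatorname{Sym}^{+}(3)$ is the set of real symmetric positive-semidefinite $3\times3$ matrices and $\operatorname{Sym}^{++}(3)$ the set of symmetric positive-definite ones. For $F\in\mathbb R^{3\times 3}$ with $\det F>0$, $F=RU$ with $R\in\mathrm{SO}(3)$, $U=\sqrt{F^TF}\in\operatorname{Sym}^{++}(3)$ is the polar decomposition, and $\operatorname{polar}(F):=R$. $\mathrm D\varphi$ is the $3\times3$ matrix whose columns are the partial derivatives of $\varphi$. $\operatorname{Curl}$ of a matrix field is the usual curl applied row-wise. $\mathrm W^{1,q}(\Omega;\mathrm{SO}(3))$ is the set of $\overline R\in \mathrm W^{1,q}(\Omega;\mathbb R^{3\times3})$ with $\overline R(x)\in\mathrm{SO}(3)$ a.e. $\operatorname{Tr}_{\Gamma_d}$ is the trace on $\Gamma_d$. Functions equal a.e. are identified. *)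

theory Defs
  imports "HOL-Analysis.Analysis"
begin

section \<open>Matrices\<close>

definition sym_psd :: "(real^3^3) set" where
  "sym_psd = {A. transpose A = A \<and> (\<forall>v. 0 \<le> v \<bullet> (A *v v))}"

definition sym_pd :: "(real^3^3) set" where
  "sym_pd = {A. transpose A = A \<and> (\<forall>v. v \<noteq> 0 \<longrightarrow> 0 < v \<bullet> (A *v v))}"

definition mat_sqrt :: "real^3^3 \<Rightarrow> real^3^3" where
  "mat_sqrt A = (THE U. U \<in> sym_psd \<and> U ** U = A)"

text \<open>Only meaningful for \<open>det F > 0\<close>.\<close>

definition polar :: "real^3^3 \<Rightarrow> real^3^3" where
  "polar F = (THE R. rotation_matrix R \<and> F = R ** mat_sqrt (transpose F ** F))"


section \<open>Lipschitz domains\<close>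

text \<open>Near every boundary point the domain is, in suitable orthonormal coordinates, the part of the
  ball lying strictly above the graph of a Lipschitz function of the first two coordinates.\<close>

definition bounded_lipschitz_domain :: "(real^3) set \<Rightarrow> bool" where
  "bounded_lipschitz_domain \<Omega> \<longleftrightarrow>
     \<Omega> \<noteq> {} \<and> open \<Omega> \<and> connected \<Omega> \<and> bounded \<Omega> \<and>
     (\<forall>x\<in>frontier \<Omega>. \<exists>r>0. \<exists>(Q::real^3^3) (\<gamma>::real^2 \<Rightarrow> real) L.
        orthogonal_matrix Q \<and> L-lipschitz_on UNIV \<gamma> \<and>
        (\<forall>y\<in>ball x r. y \<in> \<Omega> \<longleftrightarrow> \<gamma> (vector [(Q *v y) $ 1, (Q *v y) $ 2]) < (Q *v y) $ 3))"


section \<open>Surface measure\<close>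

text \<open>Surface measure is the two-dimensional Hausdorff measure, normalised by the factor
  \<open>pi / 4\<close> so that it agrees with area on planar sets.\<close>

definition hausdorff2_pre :: "real \<Rightarrow> (real^3) set \<Rightarrow> ennreal" where
  "hausdorff2_pre \<delta> E =
     (INF C \<in> {C :: nat \<Rightarrow> (real^3) set. E \<subseteq> (\<Union>i. C i) \<and> (\<forall>i. bounded (C i) \<and> diameter (C i) \<le> \<delta>)}.
        \<Sum>i. ennreal (pi / 4 * (diameter (C i))\<^sup>2))"

definition hausdorff2_outer :: "(real^3) set \<Rightarrow> ennreal" where
  "hausdorff2_outer E = (SUP \<delta>\<in>{0<..}. hausdorff2_pre \<delta> E)"

definition surface_measure :: "(real^3) measure" where
  "surface_measure =
     measure_of UNIV (lambda_system UNIV UNIV hausdorff2_outer) hausdorff2_outer"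

lemma hausdorff2_pre_mono: "A \<subseteq> B \<Longrightarrow> hausdorff2_pre \<delta> A \<le> hausdorff2_pre \<delta> B"
  unfolding hausdorff2_pre_def by (rule INF_superset_mono) auto

lemma hausdorff2_pre_empty: "0 < \<delta> \<Longrightarrow> hausdorff2_pre \<delta> {} = 0"
proof -
  assume "0 < \<delta>"
  then have "hausdorff2_pre \<delta> {} \<le> (\<Sum>i::nat. ennreal (pi / 4 * (diameter ({} :: (real^3) set))\<^sup>2))"
    unfolding hausdorff2_pre_def by (intro INF_lower) auto
  then show ?thesis by simp
qed

lemma hausdorff2_pre_UN:
  "hausdorff2_pre \<delta> (\<Union>i. A i) \<le> (\<Sum>i::nat. hausdorff2_pre \<delta> (A i))"
proof (rule ennreal_le_epsilon)
  let ?h = "\<lambda>E :: (real^3) set. ennreal (pi / 4 * (diameter E)\<^sup>2)"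
  fix e :: real assume e: "0 < e" and fin: "(\<Sum>i. hausdorff2_pre \<delta> (A i)) < top"
  have "\<exists>C. A n \<subseteq> (\<Union>i. C i) \<and> (\<forall>i. bounded (C i) \<and> diameter (C i) \<le> \<delta>) \<and>
          (\<Sum>i::nat. ?h (C i)) \<le> hausdorff2_pre \<delta> (A n) + ennreal (e * (1/2)^Suc n)" for n
  proof -
    have "hausdorff2_pre \<delta> (A n) < top"
      using fin by (auto simp: less_top dest!: ennreal_suminf_lessD)
    then have "hausdorff2_pre \<delta> (A n) < hausdorff2_pre \<delta> (A n) + ennreal (e * (1/2)^Suc n)"
      using e by (simp add: ennreal_less_zero_iff less_top[symmetric])
    then show ?thesis
      unfolding hausdorff2_pre_def[of \<delta> "A n"] INF_less_iff by (auto intro: less_imp_le)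
  qed
  then obtain C where C: "\<And>n. A n \<subseteq> (\<Union>i. C n i)"
      "\<And>n i. bounded (C n i) \<and> diameter (C n i) \<le> \<delta>"
      "\<And>n. (\<Sum>i::nat. ?h (C n i)) \<le> hausdorff2_pre \<delta> (A n) + ennreal (e * (1/2)^Suc n)"
    by metis
  let ?D = "\<lambda>k. C (fst (prod_decode k)) (snd (prod_decode k))"
  have "(\<Union>n. A n) \<subseteq> (\<Union>k. ?D k)"
  proof
    fix x assume "x \<in> (\<Union>n. A n)"
    then obtain n i where "x \<in> C n i" using C(1) by blast
    then have "x \<in> ?D (prod_encode (n, i))" by simp
    then show "x \<in> (\<Union>k. ?D k)" by blast
  qed
  then have "hausdorff2_pre \<delta> (\<Union>n. A n) \<le> (\<Sum>k. ?h (?D k))"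
    unfolding hausdorff2_pre_def using C(2) by (intro INF_lower) auto
  also have "\<dots> = (\<Sum>n. \<Sum>i. ?h (C n i))"
  proof -
    have "(\<Sum>k. (\<lambda>m. ?h (C (fst m) (snd m))) (prod_decode k)) = (\<Sum>n. \<Sum>i. ?h (C n i))"
      by (rule suminf_ennreal_2dimen) (simp only: fst_conv snd_conv)
    then show ?thesis .
  qed
  also have "\<dots> \<le> (\<Sum>n. hausdorff2_pre \<delta> (A n) + ennreal (e * (1/2)^Suc n))"
    by (intro suminf_le C(3)) auto
  also have "\<dots> = (\<Sum>n. hausdorff2_pre \<delta> (A n)) + (\<Sum>n. ennreal (e * (1/2)^Suc n))"
    by (intro suminf_add[symmetric]) auto
  also have "(\<Sum>n. ennreal (e * (1/2)^Suc n)) = ennreal e"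
    using sums_mult[OF power_half_series, of e] e by (intro suminf_ennreal_eq) auto
  finally show "hausdorff2_pre \<delta> (\<Union>n. A n) \<le> (\<Sum>n. hausdorff2_pre \<delta> (A n)) + ennreal e" .
qed

lemma outer_measure_space_hausdorff2: "outer_measure_space UNIV hausdorff2_outer"
  unfolding outer_measure_space_def
proof (intro conjI)
  show "positive UNIV hausdorff2_outer"
    by (auto simp: positive_def hausdorff2_outer_def hausdorff2_pre_empty intro!: antisym SUP_least)
  show "increasing UNIV hausdorff2_outer"
    by (auto simp: increasing_def hausdorff2_outer_def intro!: SUP_mono hausdorff2_pre_mono)
  show "countably_subadditive UNIV hausdorff2_outer"
    unfolding countably_subadditive_def hausdorff2_outer_def
    by (auto intro!: SUP_least order_trans[OF hausdorff2_pre_UN] suminf_le SUP_upper)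
qed

lemma measure_space_surface:
  "measure_space UNIV (lambda_system UNIV UNIV hausdorff2_outer) hausdorff2_outer"
  using sigma_algebra.caratheodory_lemma[of UNIV UNIV hausdorff2_outer]
    outer_measure_space_hausdorff2 sigma_algebra_Pow[of "UNIV :: (real^3) set"] by simp

lemma sets_surface_measure: "sets surface_measure = lambda_system UNIV UNIV hausdorff2_outer"
  unfolding surface_measure_def using measure_space_surface
  by (simp add: measure_space_def sigma_algebra.sets_measure_of_eq sigma_algebra.sigma_sets_eq)

lemma emeasure_surface_measure:
  "A \<in> sets surface_measure \<Longrightarrow> emeasure surface_measure A = hausdorff2_outer A"
  unfolding surface_measure_def using measure_space_surface
  by (intro emeasure_measure_of_sigma)
     (auto simp: measure_space_def sets_surface_measure[unfolded surface_measure_def])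


section \<open>Sobolev spaces\<close>

definition partial_deriv :: "3 \<Rightarrow> (real^3 \<Rightarrow> 'b) \<Rightarrow> real^3 \<Rightarrow> 'b::real_normed_vector" where
  "partial_deriv j f x = frechet_derivative f (at x) (axis j 1)"

text \<open>\<open>C\<^sup>\<infinity>\<close>: all iterated partial derivatives exist and are differentiable, hence continuous.\<close>

definition smooth :: "(real^3 \<Rightarrow> 'b::real_normed_vector) \<Rightarrow> bool" where
  "smooth f \<longleftrightarrow> (\<forall>js. fold partial_deriv js f differentiable_on UNIV)"

definition test_function :: "(real^3) set \<Rightarrow> (real^3 \<Rightarrow> real) \<Rightarrow> bool" where
  "test_function \<Omega> \<eta> \<longleftrightarrow>
     smooth \<eta> \<and> compact (closure {x. \<eta> x \<noteq> 0}) \<and> closure {x. \<eta> x \<noteq> 0} \<subseteq> \<Omega>"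

definition locally_integrable :: "(real^3) set \<Rightarrow> (real^3 \<Rightarrow> 'b::euclidean_space) \<Rightarrow> bool" where
  "locally_integrable \<Omega> u \<longleftrightarrow> (\<forall>K. compact K \<and> K \<subseteq> \<Omega> \<longrightarrow> integrable (lebesgue_on K) u)"

definition has_weak_partial ::
  "(real^3) set \<Rightarrow> 3 \<Rightarrow> (real^3 \<Rightarrow> 'b::euclidean_space) \<Rightarrow> (real^3 \<Rightarrow> 'b) \<Rightarrow> bool" where
  "has_weak_partial \<Omega> j u g \<longleftrightarrow>
     locally_integrable \<Omega> u \<and> locally_integrable \<Omega> g \<and>
     (\<forall>\<eta>. test_function \<Omega> \<eta> \<longrightarrow>
        (LINT x|lebesgue_on \<Omega>. partial_deriv j \<eta> x *\<^sub>R u x) = - (LINT x|lebesgue_on \<Omega>. \<eta> x *\<^sub>R g x))"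

text \<open>The weak derivative is determined only up to a null set; the choice operator picks a
  representative.\<close>

definition weak_partial :: "(real^3) set \<Rightarrow> 3 \<Rightarrow> (real^3 \<Rightarrow> 'b) \<Rightarrow> real^3 \<Rightarrow> 'b::euclidean_space" where
  "weak_partial \<Omega> j u = (SOME g. has_weak_partial \<Omega> j u g)"

definition Lp :: "'a measure \<Rightarrow> real \<Rightarrow> ('a \<Rightarrow> 'b::euclidean_space) set" where
  "Lp M p = {f \<in> borel_measurable M. integrable M (\<lambda>x. norm (f x) powr p)}"

definition W1 :: "real \<Rightarrow> (real^3) set \<Rightarrow> (real^3 \<Rightarrow> 'b::euclidean_space) set" where
  "W1 p \<Omega> = {u \<in> Lp (lebesgue_on \<Omega>) p. \<forall>j. \<exists>g \<in> Lp (lebesgue_on \<Omega>) p. has_weak_partial \<Omega> j u g}"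

definition W1_SO3 :: "real \<Rightarrow> (real^3) set \<Rightarrow> (real^3 \<Rightarrow> real^3^3) set" where
  "W1_SO3 q \<Omega> = {R \<in> W1 q \<Omega>. AE x in lebesgue_on \<Omega>. rotation_matrix (R x)}"

definition weak_jacobian :: "(real^3) set \<Rightarrow> (real^3 \<Rightarrow> real^3) \<Rightarrow> real^3 \<Rightarrow> real^3^3" where
  "weak_jacobian \<Omega> \<phi> x = (\<chi> i j. weak_partial \<Omega> j \<phi> x $ i)"

definition weak_Curl :: "(real^3) set \<Rightarrow> (real^3 \<Rightarrow> real^3^3) \<Rightarrow> real^3 \<Rightarrow> real^3^3" where
  "weak_Curl \<Omega> P x = (\<chi> i.
     let d = (\<lambda>j k. weak_partial \<Omega> j P x $ i $ k)
     in vector [d 2 3 - d 3 2, d 3 1 - d 1 3, d 1 2 - d 2 1])"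


section \<open>Traces\<close>

text \<open>The trace operator is the continuous extension to \<open>W\<^sup>1\<^sup>,\<^sup>p\<close> of the restriction to the boundary
  of functions smooth up to the boundary, so \<open>g\<close> is the trace of \<open>u\<close> iff the pair \<open>(u, g)\<close> is a
  limit in \<open>W\<^sup>1\<^sup>,\<^sup>p \<times> L\<^sup>p\<close> of pairs of a smooth function and its boundary values.\<close>

definition has_trace ::
  "(real^3) set \<Rightarrow> real \<Rightarrow> (real^3 \<Rightarrow> 'b::euclidean_space) \<Rightarrow> (real^3 \<Rightarrow> 'b) \<Rightarrow> bool" where
  "has_trace \<Omega> p u g \<longleftrightarrow>
     u \<in> W1 p \<Omega> \<and> g \<in> Lp (restrict_space surface_measure (frontier \<Omega>)) p \<and>
     (\<exists>v :: nat \<Rightarrow> real^3 \<Rightarrow> 'b.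
        (\<forall>n. smooth (v n)) \<and>
        (\<lambda>n. \<integral>\<^sup>+ x. ennreal (norm (v n x - u x) powr p) \<partial>lebesgue_on \<Omega>) \<longlonglongrightarrow> 0 \<and>
        (\<forall>j. (\<lambda>n. \<integral>\<^sup>+ x. ennreal (norm (partial_deriv j (v n) x - weak_partial \<Omega> j u x) powr p)
                    \<partial>lebesgue_on \<Omega>) \<longlonglongrightarrow> 0) \<and>
        (\<lambda>n. \<integral>\<^sup>+ x. ennreal (norm (v n x - g x) powr p)
               \<partial>restrict_space surface_measure (frontier \<Omega>)) \<longlonglongrightarrow> 0)"

definition trace_on_eq ::
  "(real^3) set \<Rightarrow> real \<Rightarrow> (real^3) set \<Rightarrow> (real^3 \<Rightarrow> 'b::euclidean_space) \<Rightarrow> (real^3 \<Rightarrow> 'b) \<Rightarrow> bool" where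
  "trace_on_eq \<Omega> p \<Gamma> u h \<longleftrightarrow>
     (\<exists>g. has_trace \<Omega> p u g \<and> (AE x in restrict_space surface_measure \<Gamma>. g x = h x))"

text \<open>The Sobolev--Slobodeckij space \<open>W\<^sup>s\<^sup>,\<^sup>p(\<Gamma>)\<close>, for \<open>0 < s < 1\<close>, on a two-dimensional
  surface \<open>\<Gamma>\<close>.\<close>

definition slobodeckij :: "real \<Rightarrow> real \<Rightarrow> (real^3) set \<Rightarrow> (real^3 \<Rightarrow> 'b::euclidean_space) set" where
  "slobodeckij s p \<Gamma> = {g \<in> Lp (restrict_space surface_measure \<Gamma>) p.
     (\<integral>\<^sup>+ x. \<integral>\<^sup>+ y. ennreal (norm (g x - g y) powr p / norm (x - y) powr (2 + s * p))
        \<partial>restrict_space surface_measure \<Gamma> \<partial>restrict_space surface_measure \<Gamma>) < \<infinity>}"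


section \<open>Identification of functions equal almost everywhere\<close>

definition ae_class :: "(real^3) set \<Rightarrow> (real^3 \<Rightarrow> 'b) \<Rightarrow> (real^3 \<Rightarrow> 'b) set" where
  "ae_class \<Omega> f = {g. AE x in lebesgue_on \<Omega>. g x = f x}"


section \<open>Admissible sets\<close>

definition polar_field :: "(real^3) set \<Rightarrow> (real^3 \<Rightarrow> real^3) \<Rightarrow> real^3 \<Rightarrow> real^3^3" where
  "polar_field \<Omega> \<phi> x = polar (weak_jacobian \<Omega> \<phi> x)"

definition A_relax ::
  "(real^3) set \<Rightarrow> (real^3) set \<Rightarrow> real \<Rightarrow> real \<Rightarrow> (real^3 \<Rightarrow> real^3) \<Rightarrow>
   ((real^3 \<Rightarrow> real^3) \<times> (real^3 \<Rightarrow> real^3^3)) set" where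
  "A_relax \<Omega> \<Gamma> p q \<phi>s = {(\<phi>, R). \<phi> \<in> W1 p \<Omega> \<and> R \<in> W1_SO3 q \<Omega> \<and>
     trace_on_eq \<Omega> p \<Gamma> \<phi> \<phi>s \<and>
     (AE x in lebesgue_on \<Omega>. transpose (R x) ** weak_jacobian \<Omega> \<phi> x \<in> sym_psd) \<and>
     (AE x in lebesgue_on \<Omega>. 0 < det (weak_jacobian \<Omega> \<phi> x))}"

definition A_pol ::
  "(real^3) set \<Rightarrow> (real^3) set \<Rightarrow> real \<Rightarrow> real \<Rightarrow> (real^3 \<Rightarrow> real^3) \<Rightarrow> (real^3 \<Rightarrow> real^3) set" where
  "A_pol \<Omega> \<Gamma> p q \<phi>s = {\<phi>. \<phi> \<in> W1 p \<Omega> \<and> trace_on_eq \<Omega> p \<Gamma> \<phi> \<phi>s \<and>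
     (AE x in lebesgue_on \<Omega>. 0 < det (weak_jacobian \<Omega> \<phi> x)) \<and>
     polar_field \<Omega> \<phi> \<in> W1_SO3 q \<Omega>}"

text \<open>The map sending the class of \<open>\<phi>\<close> to the pair of the classes of \<open>\<phi>\<close> and of its polar
  field. As usual for lifts to a quotient, the union is taken over all representatives.\<close>

definition polar_map ::
  "(real^3) set \<Rightarrow> (real^3 \<Rightarrow> real^3) set \<Rightarrow> (real^3 \<Rightarrow> real^3) set \<times> (real^3 \<Rightarrow> real^3^3) set" where
  "polar_map \<Omega> c = (c, \<Union>\<phi>\<in>c. ae_class \<Omega> (polar_field \<Omega> \<phi>))"


section \<open>Energies\<close>

text \<open>Integration of extended-real functions, well defined unless the positive and the negative
  part both have infinite integral; \<open>e2ennreal\<close> truncates negative values to \<open>0\<close>.\<close>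

definition ereal_integral :: "'a measure \<Rightarrow> ('a \<Rightarrow> ereal) \<Rightarrow> ereal" where
  "ereal_integral M f =
     enn2ereal (\<integral>\<^sup>+ x. e2ennreal (f x) \<partial>M) - enn2ereal (\<integral>\<^sup>+ x. e2ennreal (- f x) \<partial>M)"

definition ereal_integral_well_defined :: "'a measure \<Rightarrow> ('a \<Rightarrow> ereal) \<Rightarrow> bool" where
  "ereal_integral_well_defined M f \<longleftrightarrow> f \<in> borel_measurable M \<and>
     ((\<integral>\<^sup>+ x. e2ennreal (f x) \<partial>M) < \<infinity> \<or> (\<integral>\<^sup>+ x. e2ennreal (- f x) \<partial>M) < \<infinity>)"

definition I_density ::
  "(real^3) set \<Rightarrow> (real^3 \<Rightarrow> real^3^3 \<Rightarrow> real^3^3 \<Rightarrow> ereal) \<Rightarrow>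
   (real^3 \<Rightarrow> real^3) \<Rightarrow> (real^3 \<Rightarrow> real^3^3) \<Rightarrow> real^3 \<Rightarrow> ereal" where
  "I_density \<Omega> W \<phi> R x =
     W x (transpose (R x) ** weak_jacobian \<Omega> \<phi> x) (transpose (R x) ** weak_Curl \<Omega> R x)"

definition J_density ::
  "(real^3) set \<Rightarrow> (real^3 \<Rightarrow> real^3^3 \<Rightarrow> real^3^3 \<Rightarrow> ereal) \<Rightarrow>
   (real^3 \<Rightarrow> real^3) \<Rightarrow> real^3 \<Rightarrow> ereal" where
  "J_density \<Omega> W \<phi> x =
     W x (mat_sqrt (transpose (weak_jacobian \<Omega> \<phi> x) ** weak_jacobian \<Omega> \<phi> x))
       (transpose (polar_field \<Omega> \<phi> x) ** weak_Curl \<Omega> (polar_field \<Omega> \<phi>) x)"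

definition I_energy ::
  "(real^3) set \<Rightarrow> (real^3 \<Rightarrow> real^3^3 \<Rightarrow> real^3^3 \<Rightarrow> ereal) \<Rightarrow>
   (real^3 \<Rightarrow> real^3) \<Rightarrow> (real^3 \<Rightarrow> real^3^3) \<Rightarrow> ereal" where
  "I_energy \<Omega> W \<phi> R = ereal_integral (lebesgue_on \<Omega>) (I_density \<Omega> W \<phi> R)"

definition J_energy ::
  "(real^3) set \<Rightarrow> (real^3 \<Rightarrow> real^3^3 \<Rightarrow> real^3^3 \<Rightarrow> ereal) \<Rightarrow> (real^3 \<Rightarrow> real^3) \<Rightarrow> ereal" where
  "J_energy \<Omega> W \<phi> = ereal_integral (lebesgue_on \<Omega>) (J_density \<Omega> W \<phi>)"

end

theory Submission
  imports Defs
begin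

text \<open>The theorem is pointwise linear algebra combined with the fact that all the objects involved
  depend only on almost everywhere classes.

  The linear algebra is the polar decomposition. Let \<open>det F > 0\<close>. If \<open>R\<close> is a rotation and
  \<open>R\<^sup>T F\<close> is symmetric and positive semidefinite, then \<open>R\<^sup>T F\<close> is a positive semidefinite square root
  of \<open>F\<^sup>T F\<close>. Such a root is unique (\<open>psd_square_root_unique\<close>), and it is invertible, so \<open>R\<close> is determined
  by \<open>F\<close>, and the constraint \<open>R\<^sup>T D\<phi> \<in> Sym\<^sup>+\<close> says exactly that \<open>R = polar (D\<phi>)\<close> (\<open>polar_eqI\<close>). A
  rotation of this kind exists because a maximiser of \<open>tr (Q\<^sup>T F)\<close> over the orthogonal group makes
  \<open>Q\<^sup>T F\<close> symmetric and positive semidefinite (\<open>orthogonal_psd_factorization\<close>). Such a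
  \<open>Q\<close> has positive determinant because that of a positive semidefinite matrix is nonnegative
  (\<open>det_psd_nonneg\<close>).

  Applied almost everywhere, existence sends a polar-admissible \<open>\<phi>\<close> to a relaxed-admissible pair
  and uniqueness shows that every relaxed-admissible pair arises in this way, where the Sobolev
  regularity of the polar field comes from that of \<open>R\<close>. The map is injective since it retains \<open>\<phi>\<close>.
  Independence of representatives rests on \<open>weak_partial_cong_AE\<close>: functions equal almost everywhere
  have literally the same chosen weak derivatives. Therefore the energy densities coincide almost
  everywhere, and so do the energies.\<close>

section \<open>Positive semidefinite matrices\<close>

text \<open>The first-order condition at a minimum: a linear term in \<open>t\<close> cannot stay below a quadratic one
  for small \<open>t\<close> of both signs unless it vanishes.\<close>

lemma first_order_term_eq_0:
  fixes a b :: real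
  assumes "\<And>t. t * a \<le> t\<^sup>2 * b"
  shows "a = 0"
proof -
  define s where "s = 1 + \<bar>b\<bar>"
  have s: "0 < s" "b < s"
    by (auto simp: s_def)
  have "a / s * a \<le> (a / s)\<^sup>2 * b"
    by (rule assms)
  then have "a\<^sup>2 * s \<le> a\<^sup>2 * b"
    using s by (simp add: field_simps power2_eq_square)
  then have "a\<^sup>2 * (s - b) \<le> 0"
    by (simp add: algebra_simps)
  then show ?thesis
    using s by (simp add: mult_le_0_iff)
qed

text \<open>The vector \<open>x\<close> minimises the nonnegative quadratic form, so the derivative of the form at \<open>x\<close>
  vanishes in every direction; in the direction \<open>U x\<close> it is twice the squared norm of \<open>U x\<close>.\<close>

lemma psd_quadratic_form_eq_0:
  fixes U :: "real^'n^'n"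
  assumes sym: "transpose U = U" and psd: "\<And>v. 0 \<le> v \<bullet> (U *v v)"
    and "x \<bullet> (U *v x) = 0"
  shows "U *v x = 0"
proof -
  let ?y = "U *v x"
  have sw: "x \<bullet> (U *v ?y) = ?y \<bullet> ?y"
    by (metis dot_lmul_matrix sym vector_transpose_matrix)
  have "t * (2 * (?y \<bullet> ?y)) \<le> t\<^sup>2 * (?y \<bullet> (U *v ?y))" for t
  proof -
    have "(x - t *\<^sub>R ?y) \<bullet> (U *v (x - t *\<^sub>R ?y))
        = t\<^sup>2 * (?y \<bullet> (U *v ?y)) - t * (2 * (?y \<bullet> ?y))"
      using assms(3) sw
      by (simp add: matrix_vector_mult_diff_distrib matrix_vector_mult_scaleR inner_diff_left
          inner_diff_right power2_eq_square algebra_simps)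
    then show ?thesis
      using psd[of "x - t *\<^sub>R ?y"] by simp
  qed
  then have "2 * (?y \<bullet> ?y) = 0"
    by (rule first_order_term_eq_0)
  then show ?thesis by simp
qed

lemma trace_conj:
  fixes D U :: "real^'n^'n"
  shows "trace (transpose D ** U ** D) = (\<Sum>i\<in>UNIV. column i D \<bullet> (U *v column i D))"
proof -
  have "(transpose D ** U ** D) $ i $ i = column i D \<bullet> (U *v column i D)" for i
    by (simp add: matrix_matrix_mult_def matrix_vector_mult_def column_def transpose_def
        inner_vec_def sum_distrib_left sum_distrib_right mult.assoc)
       (rule sum.swap)
  then show ?thesis
    by (simp add: trace_def)
qed

text \<open>The trace is a sum of values of the quadratic form of \<open>U\<close> at the columns of \<open>D\<close>. None of
  them is negative, so all vanish, and each column lies in the kernel of \<open>U\<close>.\<close>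

lemma trace_conj_psd_eq_0:
  fixes D U :: "real^'n^'n"
  assumes sym: "transpose U = U" and psd: "\<And>v. 0 \<le> v \<bullet> (U *v v)"
    and "trace (transpose D ** U ** D) \<le> 0"
  shows "U ** D = 0"
proof -
  have "(\<Sum>i\<in>UNIV. column i D \<bullet> (U *v column i D)) = 0"
    using assms(3) by (intro antisym sum_nonneg psd) (simp add: trace_conj)
  then have "column i D \<bullet> (U *v column i D) = 0" for i
    by (subst (asm) sum_nonneg_eq_0_iff) (auto intro: psd)
  then have "U *v column i D = 0" for i
    by (rule psd_quadratic_form_eq_0[OF sym psd])
  then show ?thesis
    by (simp add: vec_eq_iff matrix_matrix_mult_def matrix_vector_mult_def column_def)
qed

text \<open>For the difference \<open>D = U - V\<close> one has \<open>U D + D V = U\<^sup>2 - V\<^sup>2 = 0\<close>. Multiplying by \<open>D\<close> and taking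
  traces shows that the nonnegative numbers \<open>tr (D U D)\<close> and \<open>tr (D V D)\<close> add up to \<open>0\<close>. Hence \<open>U\<close> and
  \<open>V\<close> both annihilate \<open>D\<close>, so \<open>D\<^sup>2 = 0\<close>, and \<open>D = 0\<close> because \<open>D\<close> is symmetric.\<close>

lemma psd_square_root_unique:
  fixes U V :: "real^'n^'n"
  assumes U: "transpose U = U" "\<And>v. 0 \<le> v \<bullet> (U *v v)"
    and V: "transpose V = V" "\<And>v. 0 \<le> v \<bullet> (V *v v)"
    and eq: "U ** U = V ** V"
  shows "U = V"
proof -
  define D where "D = U - V"
  have D_sym: "transpose D = D"
    using U(1) V(1) by (simp add: D_def transpose_def vec_eq_iff)
  have diff_l: "(A - B) ** C = A ** C - B ** C" for A B C :: "real^'n^'n"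
    by (simp add: matrix_eq matrix_vector_mult_diff_rdistrib flip: matrix_vector_mul_assoc)
  have diff_r: "C ** (A - B) = C ** A - C ** B" for A B C :: "real^'n^'n"
    by (simp add: matrix_eq matrix_vector_mult_diff_rdistrib matrix_vector_mult_diff_distrib
        flip: matrix_vector_mul_assoc)
  have "U ** D + D ** V = 0"
    by (simp add: D_def diff_l diff_r eq)
  then have "U ** D = - (D ** V)"
    by (simp add: eq_neg_iff_add_eq_0)
  then have "D ** (U ** D) = - (D ** (D ** V))"
    using diff_r[of D 0 "D ** V"] diff_r[of D 0 0] by simp
  moreover have "trace (- (D ** (D ** V))) = - trace (D ** (D ** V))"
    by (simp add: trace_def sum_negf)
  moreover have "trace (D ** (D ** V)) = trace (D ** V ** D)"
    by (rule trace_mul_sym)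
  ultimately have "trace (D ** U ** D) = - trace (D ** V ** D)"
    by (simp add: matrix_mul_assoc)
  moreover have nonneg: "0 \<le> trace (D ** W ** D)" if W: "\<And>v. 0 \<le> v \<bullet> (W *v v)" for W
    using trace_conj[of D W] W by (simp add: D_sym sum_nonneg)
  ultimately have "trace (D ** U ** D) \<le> 0" "trace (D ** V ** D) \<le> 0"
    using nonneg[OF U(2)] nonneg[OF V(2)] by auto
  then have "U ** D = 0" "V ** D = 0"
    using trace_conj_psd_eq_0[OF U] trace_conj_psd_eq_0[OF V] by (auto simp: D_sym)
  then have "transpose D ** D = 0"
    unfolding D_sym by (subst D_def) (simp add: diff_l)
  then have "(D *v x) \<bullet> (D *v x) = 0" for x
    by (metis dot_lmul_matrix inner_zero_right matrix_vector_mul_assoc matrix_vector_mult_0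
        vector_transpose_matrix D_sym)
  then have "D *v x = 0" for x
    by simp
  then show ?thesis
    by (simp add: D_def matrix_eq matrix_vector_mult_diff_rdistrib)
qed

text \<open>On the segment from the identity to \<open>U\<close> every matrix other than \<open>U\<close> itself has a positive
  quadratic form and so is invertible. By the intermediate value theorem the determinant, which is \<open>1\<close>
  at the identity, cannot become negative at \<open>U\<close>.\<close>

lemma det_psd_nonneg:
  fixes U :: "real^'n^'n"
  assumes psd: "\<And>v. 0 \<le> v \<bullet> (U *v v)"
  shows "0 \<le> det U"
proof (rule ccontr)
  define M where "M t = (\<chi> i j. t * U $ i $ j + (1 - t) * mat 1 $ i $ j)" for t :: real
  have M_apply: "M t *v x = t *\<^sub>R (U *v x) + (1 - t) *\<^sub>R x" for t x
  proof -
    have "M t = t *\<^sub>R U + (1 - t) *\<^sub>R mat 1"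
      by (simp add: M_def vec_eq_iff)
    then show ?thesis
      by (simp add: matrix_vector_mult_add_rdistrib flip: scaleR_matrix_vector_assoc)
  qed
  assume neg: "\<not> 0 \<le> det U"
  have ends: "M 0 = mat 1" "M 1 = U"
    by (simp_all add: M_def vec_eq_iff)
  have "continuous_on {0..1} (\<lambda>t. det (M t))"
    unfolding det_def M_def by (auto intro!: continuous_intros)
  then obtain t where t: "0 \<le> t" "t \<le> 1" "det (M t) = 0"
    using IVT2'[of "\<lambda>t. det (M t)" 1 0 0] neg by (auto simp: ends)
  have "t < 1"
    using t neg ends by (cases "t = 1") auto
  have "x = 0" if "M t *v x = 0" for x
  proof -
    have "0 = x \<bullet> (M t *v x)"
      using that by simp
    also have "\<dots> = t * (x \<bullet> (U *v x)) + (1 - t) * (x \<bullet> x)"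
      by (simp add: M_apply inner_add_right)
    finally have "(1 - t) * (x \<bullet> x) \<le> 0"
      using mult_nonneg_nonneg[OF t(1) psd[of x]] by linarith
    then show ?thesis
      using \<open>t < 1\<close> inner_ge_zero[of x] by (simp add: mult_le_0_iff antisym)
  qed
  then have "invertible (M t)"
    by (simp add: invertible_left_inverse matrix_left_invertible_ker)
  then show False
    using t invertible_det_nz by blast
qed

section \<open>Orthogonal factorization by trace maximization\<close>

text \<open>The reflection in the hyperplane orthogonal to \<open>v\<close>; division by zero makes it the identity for
  \<open>v = 0\<close>, so it is orthogonal for every \<open>v\<close>.\<close>

definition householder :: "real^'n \<Rightarrow> real^'n^'n" where
  "householder v = (\<chi> i j. (if i = j then 1 else 0) - 2 / (v \<bullet> v) * (v $ i * v $ j))"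

lemma householder_apply: "householder v *v x = x - (2 / (v \<bullet> v) * (v \<bullet> x)) *\<^sub>R v"
proof -
  have "(householder v *v x) $ i = (x - (2 / (v \<bullet> v) * (v \<bullet> x)) *\<^sub>R v) $ i" for i
  proof -
    let ?c = "2 / (v \<bullet> v)"
    have "(householder v *v x) $ i
        = (\<Sum>j\<in>UNIV. (if i = j then x $ j else 0) - ?c * v $ i * (v $ j * x $ j))"
      unfolding householder_def matrix_vector_mult_def
      by (simp, rule sum.cong) (auto simp: algebra_simps)
    also have "\<dots> = x $ i - ?c * v $ i * (v \<bullet> x)"
      unfolding sum_subtractf sum_distrib_left[symmetric] by (simp add: inner_vec_def)
    finally show ?thesis by simp
  qed
  then show ?thesis
    by (simp add: vec_eq_iff)
qed

lemma orthogonal_householder: "orthogonal_matrix (householder v)"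
proof -
  have "transpose (householder v) = householder v"
    by (auto simp: householder_def transpose_def vec_eq_iff)
  moreover have "householder v *v (householder v *v x) = x" for x
    by (cases "v = 0") (simp_all add: householder_apply inner_diff_right)
  ultimately show ?thesis
    by (simp add: orthogonal_matrix matrix_eq flip: matrix_vector_mul_assoc)
qed

lemma trace_householder_mul:
  "trace (householder v ** M) = trace M - 2 / (v \<bullet> v) * (v \<bullet> (M *v v))"
proof -
  have "trace (householder v ** M) = (\<Sum>i\<in>UNIV. (householder v *v column i M) $ i)"
    by (simp add: trace_def matrix_matrix_mult_def matrix_vector_mult_def column_def)
  also have "\<dots> = trace M - 2 / (v \<bullet> v) * (\<Sum>i\<in>UNIV. (v \<bullet> column i M) * v $ i)"
    by (simp add: householder_apply trace_def column_def sum_subtractf sum_distrib_left mult_ac)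
  also have "(\<Sum>i\<in>UNIV. (v \<bullet> column i M) * v $ i) = v \<bullet> (M *v v)"
    by (simp add: inner_vec_def column_def matrix_vector_mult_def sum_distrib_left
        sum_distrib_right mult.assoc) (rule sum.swap)
  finally show ?thesis .
qed

text \<open>For independent \<open>v\<close> and \<open>w\<close> the product is a rotation in the plane they span; its effect on the trace
  contains the mixed term \<open>w \<bullet> M v\<close>, which detects the skew part of \<open>M\<close>.\<close>

lemma trace_householder_householder_mul:
  "trace (householder v ** (householder w ** M)) = trace M - 2 / (w \<bullet> w) * (w \<bullet> (M *v w))
    - 2 / (v \<bullet> v) * (v \<bullet> (M *v v) - 2 / (w \<bullet> w) * (w \<bullet> (M *v v)) * (v \<bullet> w))"
proof -
  have "v \<bullet> ((householder w ** M) *v v)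
      = v \<bullet> (M *v v) - 2 / (w \<bullet> w) * (w \<bullet> (M *v v)) * (v \<bullet> w)"
    by (simp add: householder_apply inner_diff_right flip: matrix_vector_mul_assoc)
  then show ?thesis
    by (simp add: trace_householder_mul)
qed

lemma compact_orthogonal_matrices: "compact {Q :: real^'n^'n. orthogonal_matrix Q}"
proof -
  have "norm Q \<le> real CARD('n)" if "orthogonal_matrix Q" for Q :: "real^'n^'n"
  proof -
    have "norm (Q $ i) = 1" for i
      using that orthogonal_matrix_orthonormal_rows[of Q] by (simp add: row_def)
    then show ?thesis
      using L2_set_le_sum[of UNIV "\<lambda>i. norm (Q $ i)"] by (simp add: norm_vec_def)
  qed
  then have "bounded {Q :: real^'n^'n. orthogonal_matrix Q}"
    by (auto intro: boundedI)
  moreover have "closed {Q :: real^'n^'n. orthogonal_matrix Q}"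
    unfolding orthogonal_matrix matrix_matrix_mult_def transpose_def
    by (intro closed_Collect_eq continuous_intros)
  ultimately show ?thesis
    by (simp add: compact_eq_bounded_closed)
qed

text \<open>Take \<open>Q\<close> that maximises \<open>tr (Q\<^sup>T F)\<close> over the compact orthogonal group and put \<open>U = Q\<^sup>T F\<close>.
  Then \<open>tr (P U) \<le> tr U\<close> for all orthogonal \<open>P\<close>. Reflections \<open>P\<close> show that the quadratic form of \<open>U\<close>
  is nonnegative. Small rotations \<open>P\<close> in a coordinate plane, written as products of two reflections,
  show that \<open>U\<close> is symmetric.\<close>

lemma orthogonal_psd_factorization:
  fixes F :: "real^'n^'n"
  obtains Q where "orthogonal_matrix Q" "transpose (transpose Q ** F) = transpose Q ** F"
    "\<And>v. 0 \<le> v \<bullet> ((transpose Q ** F) *v v)"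
proof -
  have "continuous_on {Q. orthogonal_matrix Q} (\<lambda>Q. trace (transpose Q ** F))"
    unfolding trace_def matrix_matrix_mult_def transpose_def
    by (auto intro!: continuous_intros)
  then obtain Q where Q: "orthogonal_matrix Q"
      and max: "\<And>P. orthogonal_matrix P \<Longrightarrow> trace (transpose P ** F) \<le> trace (transpose Q ** F)"
    using continuous_attains_sup[OF compact_orthogonal_matrices]
      orthogonal_matrix_id by (metis (no_types, lifting) empty_iff mem_Collect_eq)
  define U where "U = transpose Q ** F"
  have opt: "trace (P ** U) \<le> trace U" if "orthogonal_matrix P" for P
    using max[of "Q ** transpose P"] Q that
    by (simp add: U_def matrix_transpose_mul matrix_mul_assoc orthogonal_matrix_mul)
  have psd: "0 \<le> v \<bullet> (U *v v)" for v
  proof (cases "v = 0")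
    case False
    then have "0 < v \<bullet> v"
      by simp
    then show ?thesis
      using opt[OF orthogonal_householder[of v]]
      by (simp add: trace_householder_mul zero_le_divide_iff del: inner_gt_zero_iff)
  qed simp
  have "U $ j $ i = U $ i $ j" for i j
  proof (cases "i = j")
    case False
    let ?v = "axis i 1 :: real^'n" and ?z = "axis j 1 :: real^'n"
    have orth: "?v \<bullet> ?v = 1" "?z \<bullet> ?z = 1" "?v \<bullet> ?z = 0" "?z \<bullet> ?v = 0"
      using False by (auto simp: inner_axis_axis)
    \<comment> \<open>Reflecting along \<open>w = v + t z\<close> and then along \<open>v\<close> is a rotation of the \<open>(v, z)\<close> plane by an angle
      of order \<open>t\<close>; the first-order change of the trace is a multiple of the difference of the two entries.\<close>
    have "t * (?z \<bullet> (U *v ?v) - ?v \<bullet> (U *v ?z)) \<le> t\<^sup>2 * (?z \<bullet> (U *v ?z) + ?v \<bullet> (U *v ?v))" for t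
    proof -
      define w where "w = ?v + t *\<^sub>R ?z"
      define a c d e where ac: "a = ?v \<bullet> (U *v ?v)" "c = ?z \<bullet> (U *v ?v)"
        and de: "d = ?v \<bullet> (U *v ?z)" "e = ?z \<bullet> (U *v ?z)"
      have w: "w \<bullet> w = 1 + t\<^sup>2" "?v \<bullet> w = 1"
        by (simp_all add: w_def inner_add_left inner_add_right orth power2_eq_square)
      have pos: "0 < 1 + t\<^sup>2"
        by (simp add: add_pos_nonneg)
      have Uv: "w \<bullet> (U *v ?v) = a + t * c"
        by (simp add: w_def ac inner_add_left)
      have Uw: "w \<bullet> (U *v w) = a + t * c + t * d + t\<^sup>2 * e"
        by (simp add: w_def ac de inner_add_left inner_add_right matrix_vector_right_distrib
            matrix_vector_mult_scaleR power2_eq_square algebra_simps)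
      have "trace (householder ?v ** (householder w ** U)) \<le> trace U"
        using opt[OF orthogonal_matrix_mul[OF orthogonal_householder orthogonal_householder]]
        by (simp add: matrix_mul_assoc)
      then have "2 * (2 / (1 + t\<^sup>2) * (a + t * c))
          \<le> 2 / (1 + t\<^sup>2) * (a + t * c + t * d + t\<^sup>2 * e) + 2 * a"
        unfolding trace_householder_householder_mul w orth Uv Uw ac(1)[symmetric] by simp
      moreover have "2 * y \<le> x + a * s" if "2 * (2 / s * y) \<le> 2 / s * x + 2 * a" "0 < s"
        for x y s :: real
        using that by (simp add: field_simps)
      ultimately have "2 * (a + t * c) \<le> (a + t * c + t * d + t\<^sup>2 * e) + a * (1 + t\<^sup>2)"
        using pos by blast
      then show ?thesis
        unfolding ac[symmetric] de[symmetric] by (simp add: algebra_simps)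
    qed
    then have "?z \<bullet> (U *v ?v) - ?v \<bullet> (U *v ?z) = 0"
      by (rule first_order_term_eq_0)
    then show ?thesis
      by (simp add: inner_axis' matrix_vector_mult_basis column_def)
  qed simp
  then have "transpose U = U"
    by (simp add: transpose_def vec_eq_iff)
  then show ?thesis
    using that Q psd unfolding U_def by blast
qed

section \<open>Polar decomposition\<close>

lemma mat_sqrt_eqI:
  assumes "U \<in> sym_psd" "U ** U = A"
  shows "mat_sqrt A = U"
  unfolding mat_sqrt_def
proof (rule the_equality)
  show "U \<in> sym_psd \<and> U ** U = A"
    using assms by simp
  fix V assume "V \<in> sym_psd \<and> V ** V = A"
  then show "V = U"
    using assms psd_square_root_unique[of V U] by (simp add: sym_psd_def)
qed

text \<open>By symmetry and orthogonality the square of \<open>R\<^sup>T F\<close> is \<open>F\<^sup>T R R\<^sup>T F = F\<^sup>T F\<close>.\<close>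

lemma mat_sqrt_gram_eqI:
  assumes "orthogonal_matrix R" "transpose R ** F \<in> sym_psd"
  shows "mat_sqrt (transpose F ** F) = transpose R ** F"
proof (rule mat_sqrt_eqI)
  have "(transpose R ** F) ** (transpose R ** F) = transpose (transpose R ** F) ** (transpose R ** F)"
    using assms(2) by (simp add: sym_psd_def)
  also have "\<dots> = transpose F ** (R ** transpose R) ** F"
    by (simp add: matrix_transpose_mul matrix_mul_assoc)
  finally show "(transpose R ** F) ** (transpose R ** F) = transpose F ** F"
    using assms(1) by (simp add: orthogonal_matrix_def)
qed (fact assms(2))

lemma invertible_psd_imp_pd:
  assumes "U \<in> sym_psd" "det U \<noteq> 0"
  shows "U \<in> sym_pd"
proof -
  have "v = 0" if "v \<bullet> (U *v v) = 0" for v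
  proof -
    have "U *v v = 0"
      using assms(1) that by (intro psd_quadratic_form_eq_0) (auto simp: sym_psd_def)
    then show ?thesis
      using assms(2) invertible_det_nz invertible_left_inverse matrix_left_invertible_ker by metis
  qed
  then show ?thesis
    using assms(1) by (auto simp: sym_psd_def sym_pd_def less_le)
qed

text \<open>Uniqueness in the polar decomposition. This is what makes the relaxed constraint exact: among
  rotations, only the polar factor can turn an orientation-preserving \<open>F\<close> into a symmetric positive
  semidefinite matrix.\<close>

lemma polar_eqI:
  assumes "0 < det F" "rotation_matrix R" "transpose R ** F \<in> sym_psd"
  shows "polar F = R"
  unfolding polar_def
proof (rule the_equality)
  let ?U = "transpose R ** F"
  have R: "orthogonal_matrix R"
    using assms(2) by (simp add: rotation_matrix_def)
  have sqrt: "mat_sqrt (transpose F ** F) = ?U"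
    by (rule mat_sqrt_gram_eqI[OF R assms(3)])
  show "rotation_matrix R \<and> F = R ** mat_sqrt (transpose F ** F)"
    using assms(2) R by (simp add: sqrt matrix_mul_assoc orthogonal_matrix_def)
  \<comment> \<open>Two rotations with the same symmetric factor agree because that factor is invertible.\<close>
  fix S assume S: "rotation_matrix S \<and> F = S ** mat_sqrt (transpose F ** F)"
  have "det ?U \<noteq> 0"
    using assms(1,2) by (simp add: det_mul rotation_matrix_def)
  then obtain V where V: "?U ** V = mat 1"
    using invertible_det_nz invertible_right_inverse by blast
  have "S ** ?U = R ** ?U"
    using S R by (simp add: sqrt matrix_mul_assoc orthogonal_matrix_def)
  then have "S ** (?U ** V) = R ** (?U ** V)"
    by (metis matrix_mul_assoc)
  then show "S = R"
    by (simp add: V)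
qed

text \<open>The orthogonal factor \<open>Q\<close> of the variational factorization is a rotation: its determinant has the
  sign of \<open>det (Q\<^sup>T F) / det F\<close>, and \<open>det (Q\<^sup>T F)\<close> is nonnegative by semidefiniteness.\<close>

lemma polar_decomposition:
  assumes "0 < det F"
  shows "rotation_matrix (polar F)"
    and "transpose (polar F) ** F = mat_sqrt (transpose F ** F)"
    and "mat_sqrt (transpose F ** F) \<in> sym_pd"
proof -
  obtain Q where Q: "orthogonal_matrix Q" "transpose Q ** F \<in> sym_psd"
    by (rule orthogonal_psd_factorization[of F]) (auto simp: sym_psd_def)
  have "0 \<le> det (transpose Q ** F)"
    using Q(2) by (intro det_psd_nonneg) (simp add: sym_psd_def)
  then have "0 \<le> det Q * det F"
    by (simp add: det_mul)
  then have "det Q = 1"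
    using det_orthogonal_matrix[OF Q(1)] assms by auto
  then have rot: "rotation_matrix Q"
    using Q(1) by (simp add: rotation_matrix_def)
  have polar: "polar F = Q"
    by (rule polar_eqI[OF assms rot Q(2)])
  show "rotation_matrix (polar F)"
    using rot by (simp add: polar)
  show "transpose (polar F) ** F = mat_sqrt (transpose F ** F)"
    by (simp add: polar mat_sqrt_gram_eqI[OF Q])
  have "det (transpose Q ** F) \<noteq> 0"
    using \<open>det Q = 1\<close> assms by (simp add: det_mul)
  then show "mat_sqrt (transpose F ** F) \<in> sym_pd"
    by (simp add: mat_sqrt_gram_eqI[OF Q] invertible_psd_imp_pd[OF Q(2)])
qed

lemma sym_pd_subset_sym_psd: "sym_pd \<subseteq> sym_psd"
proof
  fix A assume A: "A \<in> sym_pd"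
  have "0 \<le> v \<bullet> (A *v v)" for v
    using A by (cases "v = 0") (auto simp: sym_pd_def less_imp_le)
  then show "A \<in> sym_psd"
    using A by (auto simp: sym_psd_def sym_pd_def)
qed

section \<open>Almost everywhere equal functions and weak derivatives\<close>

lemma borel_measurable_lebesgue_on_AE:
  fixes u v :: "'a::euclidean_space \<Rightarrow> 'b::euclidean_space"
  assumes S: "S \<in> sets lebesgue"
    and u: "u \<in> borel_measurable (lebesgue_on S)" and ae: "AE x in lebesgue_on S. u x = v x"
  shows "v \<in> borel_measurable (lebesgue_on S)"
proof -
  have "(\<lambda>x. indicator S x *\<^sub>R u x) \<in> borel_measurable lebesgue"
    using S u by (simp add: borel_measurable_restrict_space_iff)
  moreover have "AE x in lebesgue. indicator S x *\<^sub>R u x = indicator S x *\<^sub>R v x"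
    using ae S by (auto simp: AE_restrict_space_iff indicator_def elim!: eventually_mono)
  ultimately have "(\<lambda>x. indicator S x *\<^sub>R v x) \<in> borel_measurable lebesgue"
    by (rule borel_measurable_AE)
  then show ?thesis
    using S by (simp add: borel_measurable_restrict_space_iff)
qed

lemma integrable_lebesgue_on_AE:
  fixes u v :: "'a::euclidean_space \<Rightarrow> 'b::euclidean_space"
  assumes "S \<in> sets lebesgue" "integrable (lebesgue_on S) u" "AE x in lebesgue_on S. u x = v x"
  shows "integrable (lebesgue_on S) v"
proof (rule integrable_cong_AE_imp)
  show "v \<in> borel_measurable (lebesgue_on S)"
    using borel_measurable_lebesgue_on_AE[OF assms(1) borel_measurable_integrable[OF assms(2)] assms(3)] .
qed (use assms in \<open>auto elim: eventually_mono\<close>)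

lemma integral_lebesgue_on_AE:
  fixes u v :: "'a::euclidean_space \<Rightarrow> 'b::euclidean_space"
  assumes S: "S \<in> sets lebesgue" and ae: "AE x in lebesgue_on S. u x = v x"
  shows "integral\<^sup>L (lebesgue_on S) u = integral\<^sup>L (lebesgue_on S) v"
proof (cases "integrable (lebesgue_on S) u")
  case True
  then show ?thesis
    using integrable_lebesgue_on_AE[OF S True ae] ae by (intro integral_cong_AE) auto
next
  case False
  moreover have "\<not> integrable (lebesgue_on S) v"
    using False integrable_lebesgue_on_AE[OF S, of v u] ae by (auto simp: eq_commute)
  ultimately show ?thesis
    by (simp add: not_integrable_integral_eq)
qed

text \<open>The definition of a weak derivative mentions the function only through integrals over \<open>\<Omega>\<close> and
  its compact subsets, and these do not see null sets.\<close>

lemma has_weak_partial_AE: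
  assumes "open \<Omega>" and ae: "AE x in lebesgue_on \<Omega>. u x = v x" and u: "has_weak_partial \<Omega> j u g"
  shows "has_weak_partial \<Omega> j v g"
proof -
  have \<Omega>: "\<Omega> \<in> sets lebesgue"
    using \<open>open \<Omega>\<close> by simp
  have "integrable (lebesgue_on K) v" if K: "compact K" "K \<subseteq> \<Omega>" for K
  proof (rule integrable_lebesgue_on_AE)
    show K_sets: "K \<in> sets lebesgue"
      using K(1) by (simp add: compact_imp_closed)
    show "integrable (lebesgue_on K) u"
      using u K by (auto simp: has_weak_partial_def locally_integrable_def)
    show "AE x in lebesgue_on K. u x = v x"
      using ae \<Omega> K_sets K(2) by (auto simp: AE_restrict_space_iff elim!: eventually_mono)
  qed
  then have "locally_integrable \<Omega> v"
    by (simp add: locally_integrable_def)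
  moreover have "(LINT x|lebesgue_on \<Omega>. partial_deriv j \<eta> x *\<^sub>R u x)
      = (LINT x|lebesgue_on \<Omega>. partial_deriv j \<eta> x *\<^sub>R v x)" for \<eta>
    using ae by (intro integral_lebesgue_on_AE[OF \<Omega>]) (auto elim!: eventually_mono)
  ultimately show ?thesis
    using u by (simp add: has_weak_partial_def)
qed

text \<open>This is an equality of functions at every point, not only almost everywhere. Functions that agree
  almost everywhere have the same set of weak derivatives, and the choice operator picks the same
  element from equal sets.\<close>

lemma weak_partial_cong_AE:
  assumes "open \<Omega>" "AE x in lebesgue_on \<Omega>. u x = v x"
  shows "weak_partial \<Omega> j u = weak_partial \<Omega> j v"
proof -
  have "AE x in lebesgue_on \<Omega>. v x = u x"
    using assms(2) by (simp add: eq_commute)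
  then have "has_weak_partial \<Omega> j u = has_weak_partial \<Omega> j v"
    using has_weak_partial_AE assms by (intro ext iffI) blast+
  then show ?thesis
    by (simp add: weak_partial_def)
qed

lemma W1_AE:
  assumes "open \<Omega>" and ae: "AE x in lebesgue_on \<Omega>. u x = v x" and u: "u \<in> W1 p \<Omega>"
  shows "v \<in> W1 p \<Omega>"
proof -
  have \<Omega>: "\<Omega> \<in> sets lebesgue"
    using \<open>open \<Omega>\<close> by simp
  have u_Lp: "u \<in> borel_measurable (lebesgue_on \<Omega>)"
      "integrable (lebesgue_on \<Omega>) (\<lambda>x. norm (u x) powr p)"
    using u by (auto simp: W1_def Lp_def)
  have "v \<in> borel_measurable (lebesgue_on \<Omega>)"
    by (rule borel_measurable_lebesgue_on_AE[OF \<Omega> u_Lp(1) ae])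
  moreover have "integrable (lebesgue_on \<Omega>) (\<lambda>x. norm (v x) powr p)"
    using ae by (intro integrable_lebesgue_on_AE[OF \<Omega> u_Lp(2)]) (auto elim!: eventually_mono)
  ultimately show ?thesis
    using u has_weak_partial_AE[OF \<open>open \<Omega>\<close> ae] unfolding W1_def Lp_def by blast
qed

lemma ae_class_self: "f \<in> ae_class \<Omega> f"
  by (simp add: ae_class_def)

lemma ae_class_eqI:
  assumes "g \<in> ae_class \<Omega> f"
  shows "ae_class \<Omega> g = ae_class \<Omega> f"
proof -
  have "AE x in lebesgue_on \<Omega>. g x = f x"
    using assms by (simp add: ae_class_def)
  then show ?thesis
    unfolding ae_class_def by (auto elim: eventually_elim2)
qed

lemma weak_jacobian_cong_ae_class:
  assumes "open \<Omega>" "\<psi> \<in> ae_class \<Omega> \<phi>"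
  shows "weak_jacobian \<Omega> \<psi> = weak_jacobian \<Omega> \<phi>"
proof -
  have "weak_partial \<Omega> j \<psi> = weak_partial \<Omega> j \<phi>" for j
    using assms by (intro weak_partial_cong_AE) (simp_all add: ae_class_def)
  then show ?thesis
    by (intro ext) (simp add: weak_jacobian_def)
qed

lemma weak_Curl_cong_ae_class:
  assumes "open \<Omega>" "P \<in> ae_class \<Omega> R"
  shows "weak_Curl \<Omega> P = weak_Curl \<Omega> R"
proof -
  have "weak_partial \<Omega> j P = weak_partial \<Omega> j R" for j
    using assms by (intro weak_partial_cong_AE) (simp_all add: ae_class_def)
  then show ?thesis
    by (intro ext) (simp add: weak_Curl_def)
qed

section \<open>The relaxed and the polar problem\<close>

text \<open>All representatives of the class have the same weak Jacobian, hence the same polar field, so the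
  union that defines the lift consists of a single class.\<close>

lemma polar_map_ae_class:
  assumes "open \<Omega>"
  shows "polar_map \<Omega> (ae_class \<Omega> \<phi>) = (ae_class \<Omega> \<phi>, ae_class \<Omega> (polar_field \<Omega> \<phi>))"
proof -
  have "polar_field \<Omega> \<psi> = polar_field \<Omega> \<phi>" if "\<psi> \<in> ae_class \<Omega> \<phi>" for \<psi>
    using weak_jacobian_cong_ae_class[OF assms that] by (simp add: polar_field_def fun_eq_iff)
  then have "(\<Union>\<psi>\<in>ae_class \<Omega> \<phi>. ae_class \<Omega> (polar_field \<Omega> \<psi>))
      = (\<Union>\<psi>\<in>ae_class \<Omega> \<phi>. ae_class \<Omega> (polar_field \<Omega> \<phi>))"
    by (intro SUP_cong) auto
  then show ?thesis
    using ae_class_self[of \<phi> \<Omega>] by (auto simp: polar_map_def)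
qed

lemma polar_decomposition_AE:
  assumes "AE x in lebesgue_on \<Omega>. 0 < det (weak_jacobian \<Omega> \<phi> x)" "R \<in> ae_class \<Omega> (polar_field \<Omega> \<phi>)"
  shows "AE x in lebesgue_on \<Omega>.
    transpose (R x) ** weak_jacobian \<Omega> \<phi> x
      = mat_sqrt (transpose (weak_jacobian \<Omega> \<phi> x) ** weak_jacobian \<Omega> \<phi> x) \<and>
    mat_sqrt (transpose (weak_jacobian \<Omega> \<phi> x) ** weak_jacobian \<Omega> \<phi> x) \<in> sym_pd"
proof -
  have "AE x in lebesgue_on \<Omega>. R x = polar_field \<Omega> \<phi> x"
    using assms(2) by (simp add: ae_class_def)
  with assms(1) show ?thesis
    by eventually_elim (auto simp: polar_field_def polar_decomposition)
qed

lemma A_pol_imp_A_relax: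
  assumes "\<phi> \<in> A_pol \<Omega> \<Gamma> p q \<phi>s"
  shows "(\<phi>, polar_field \<Omega> \<phi>) \<in> A_relax \<Omega> \<Gamma> p q \<phi>s"
proof -
  have det: "AE x in lebesgue_on \<Omega>. 0 < det (weak_jacobian \<Omega> \<phi> x)"
    using assms by (simp add: A_pol_def)
  have "AE x in lebesgue_on \<Omega>. transpose (polar_field \<Omega> \<phi> x) ** weak_jacobian \<Omega> \<phi> x \<in> sym_psd"
    using polar_decomposition_AE[OF det ae_class_self]
    by eventually_elim (use sym_pd_subset_sym_psd in auto)
  then show ?thesis
    using assms by (simp add: A_pol_def A_relax_def)
qed

text \<open>Uniqueness of the polar factor forces \<open>R\<close> to be the polar field almost everywhere, so the polar
  field inherits the Sobolev regularity of \<open>R\<close>.\<close>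

lemma A_relax_imp_A_pol:
  assumes "open \<Omega>" "(\<phi>, R) \<in> A_relax \<Omega> \<Gamma> p q \<phi>s"
  shows "\<phi> \<in> A_pol \<Omega> \<Gamma> p q \<phi>s" and "ae_class \<Omega> R = ae_class \<Omega> (polar_field \<Omega> \<phi>)"
proof -
  have R: "R \<in> W1 q \<Omega>" and rot: "AE x in lebesgue_on \<Omega>. rotation_matrix (R x)"
    and psd: "AE x in lebesgue_on \<Omega>. transpose (R x) ** weak_jacobian \<Omega> \<phi> x \<in> sym_psd"
    and det: "AE x in lebesgue_on \<Omega>. 0 < det (weak_jacobian \<Omega> \<phi> x)"
    using assms(2) by (auto simp: A_relax_def W1_SO3_def)
  have eq: "AE x in lebesgue_on \<Omega>. R x = polar_field \<Omega> \<phi> x"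
    using rot psd det by eventually_elim (simp add: polar_field_def polar_eqI)
  show "ae_class \<Omega> R = ae_class \<Omega> (polar_field \<Omega> \<phi>)"
    using eq by (intro ae_class_eqI) (simp add: ae_class_def)
  have "AE x in lebesgue_on \<Omega>. rotation_matrix (polar_field \<Omega> \<phi> x)"
    using rot eq by eventually_elim simp
  then have "polar_field \<Omega> \<phi> \<in> W1_SO3 q \<Omega>"
    using W1_AE[OF assms(1) eq R] by (simp add: W1_SO3_def)
  then show "\<phi> \<in> A_pol \<Omega> \<Gamma> p q \<phi>s"
    using assms(2) by (simp add: A_relax_def A_pol_def)
qed

text \<open>The two densities agree almost everywhere, and each part of the extended-real integral depends on
  its integrand only up to a null set.\<close>

lemma J_energy_eq_I_energy:
  assumes "open \<Omega>" "AE x in lebesgue_on \<Omega>. 0 < det (weak_jacobian \<Omega> \<phi> x)"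
    and R: "R \<in> ae_class \<Omega> (polar_field \<Omega> \<phi>)"
  shows "J_energy \<Omega> W \<phi> = I_energy \<Omega> W \<phi> R"
proof -
  have "AE x in lebesgue_on \<Omega>. R x = polar_field \<Omega> \<phi> x"
    using R by (simp add: ae_class_def)
  with polar_decomposition_AE[OF assms(2,3)]
  have eq: "AE x in lebesgue_on \<Omega>. J_density \<Omega> W \<phi> x = I_density \<Omega> W \<phi> R x"
    by eventually_elim
       (simp add: J_density_def I_density_def weak_Curl_cong_ae_class[OF assms(1) R])
  have "(\<integral>\<^sup>+ x. e2ennreal (J_density \<Omega> W \<phi> x) \<partial>lebesgue_on \<Omega>)
      = (\<integral>\<^sup>+ x. e2ennreal (I_density \<Omega> W \<phi> R x) \<partial>lebesgue_on \<Omega>)"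
    by (rule nn_integral_cong_AE) (use eq in eventually_elim, simp)
  moreover have "(\<integral>\<^sup>+ x. e2ennreal (- J_density \<Omega> W \<phi> x) \<partial>lebesgue_on \<Omega>)
      = (\<integral>\<^sup>+ x. e2ennreal (- I_density \<Omega> W \<phi> R x) \<partial>lebesgue_on \<Omega>)"
    by (rule nn_integral_cong_AE) (use eq in eventually_elim, simp)
  ultimately show ?thesis
    by (simp add: J_energy_def I_energy_def ereal_integral_def)
qed

theorem proposition5p1:
  fixes \<Omega> \<Gamma> :: "(real^3) set" and p q :: real and \<phi>s :: "real^3 \<Rightarrow> real^3"
  assumes "bounded_lipschitz_domain \<Omega>"
    and "openin (top_of_set (frontier \<Omega>)) \<Gamma>"
    and "\<Gamma> \<noteq> {}"
    and "0 < emeasure surface_measure \<Gamma>"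
    and "2 \<le> p" and "2 \<le> q"
    and "\<phi>s \<in> slobodeckij (1 - 1 / p) p \<Gamma>"
  shows
    "bij_betw (polar_map \<Omega>)
       (ae_class \<Omega> ` A_pol \<Omega> \<Gamma> p q \<phi>s)
       (map_prod (ae_class \<Omega>) (ae_class \<Omega>) ` A_relax \<Omega> \<Gamma> p q \<phi>s) \<and>
     (\<forall>\<phi> \<in> A_pol \<Omega> \<Gamma> p q \<phi>s.
        polar_map \<Omega> (ae_class \<Omega> \<phi>) = (ae_class \<Omega> \<phi>, ae_class \<Omega> (polar_field \<Omega> \<phi>))) \<and>
     (\<forall>\<phi> \<in> A_pol \<Omega> \<Gamma> p q \<phi>s. \<forall>R \<in> ae_class \<Omega> (polar_field \<Omega> \<phi>).
        AE x in lebesgue_on \<Omega>.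
          transpose (R x) ** weak_jacobian \<Omega> \<phi> x
            = mat_sqrt (transpose (weak_jacobian \<Omega> \<phi> x) ** weak_jacobian \<Omega> \<phi> x) \<and>
          mat_sqrt (transpose (weak_jacobian \<Omega> \<phi> x) ** weak_jacobian \<Omega> \<phi> x) \<in> sym_pd) \<and>
     (\<forall>W :: real^3 \<Rightarrow> real^3^3 \<Rightarrow> real^3^3 \<Rightarrow> ereal.
        (\<forall>x\<in>\<Omega>. \<forall>A B. W x A B \<noteq> -\<infinity>) \<and>
        (\<forall>(\<phi>, R) \<in> A_relax \<Omega> \<Gamma> p q \<phi>s.
           ereal_integral_well_defined (lebesgue_on \<Omega>) (I_density \<Omega> W \<phi> R)) \<and>
        (\<forall>\<phi> \<in> A_pol \<Omega> \<Gamma> p q \<phi>s.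
           ereal_integral_well_defined (lebesgue_on \<Omega>) (J_density \<Omega> W \<phi>)) \<longrightarrow>
        (\<forall>\<phi> \<in> A_pol \<Omega> \<Gamma> p q \<phi>s. \<forall>R \<in> ae_class \<Omega> (polar_field \<Omega> \<phi>).
           J_energy \<Omega> W \<phi> = I_energy \<Omega> W \<phi> R))"
proof (intro conjI ballI allI impI)
  have \<Omega>: "open \<Omega>"
    using assms(1) by (simp add: bounded_lipschitz_domain_def)
  note map = polar_map_ae_class[OF \<Omega>]
  let ?pol = "A_pol \<Omega> \<Gamma> p q \<phi>s" and ?relax = "A_relax \<Omega> \<Gamma> p q \<phi>s"
  have "polar_map \<Omega> ` ae_class \<Omega> ` ?pol = map_prod (ae_class \<Omega>) (ae_class \<Omega>) ` ?relax"
  proof (intro equalityI subsetI)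
    fix c assume "c \<in> polar_map \<Omega> ` ae_class \<Omega> ` ?pol"
    then obtain \<phi> where \<phi>: "\<phi> \<in> ?pol" "c = polar_map \<Omega> (ae_class \<Omega> \<phi>)"
      by blast
    then show "c \<in> map_prod (ae_class \<Omega>) (ae_class \<Omega>) ` ?relax"
      by (intro image_eqI[OF _ A_pol_imp_A_relax[OF \<phi>(1)]]) (simp add: map)
  next
    fix c assume "c \<in> map_prod (ae_class \<Omega>) (ae_class \<Omega>) ` ?relax"
    then obtain \<phi> R where R: "(\<phi>, R) \<in> ?relax" "c = (ae_class \<Omega> \<phi>, ae_class \<Omega> R)"
      by auto
    then have "c = polar_map \<Omega> (ae_class \<Omega> \<phi>)"
      using A_relax_imp_A_pol(2)[OF \<Omega> R(1)] by (simp add: map)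
    then show "c \<in> polar_map \<Omega> ` ae_class \<Omega> ` ?pol"
      using A_relax_imp_A_pol(1)[OF \<Omega> R(1)] by blast
  qed
  moreover have "inj_on (polar_map \<Omega>) (ae_class \<Omega> ` ?pol)"
    by (rule inj_onI) (simp add: polar_map_def)
  ultimately show "bij_betw (polar_map \<Omega>) (ae_class \<Omega> ` ?pol)
      (map_prod (ae_class \<Omega>) (ae_class \<Omega>) ` ?relax)"
    by (simp add: bij_betw_def)
  fix \<phi> assume "\<phi> \<in> ?pol"
  then have det: "AE x in lebesgue_on \<Omega>. 0 < det (weak_jacobian \<Omega> \<phi> x)"
    by (simp add: A_pol_def)
  show "polar_map \<Omega> (ae_class \<Omega> \<phi>) = (ae_class \<Omega> \<phi>, ae_class \<Omega> (polar_field \<Omega> \<phi>))"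
    by (rule map)
  fix R assume R: "R \<in> ae_class \<Omega> (polar_field \<Omega> \<phi>)"
  show "AE x in lebesgue_on \<Omega>.
      transpose (R x) ** weak_jacobian \<Omega> \<phi> x
        = mat_sqrt (transpose (weak_jacobian \<Omega> \<phi> x) ** weak_jacobian \<Omega> \<phi> x) \<and>
      mat_sqrt (transpose (weak_jacobian \<Omega> \<phi> x) ** weak_jacobian \<Omega> \<phi> x) \<in> sym_pd"
    by (rule polar_decomposition_AE[OF det R])
  show "J_energy \<Omega> W \<phi> = I_energy \<Omega> W \<phi> R" for W
    by (rule J_energy_eq_I_energy[OF \<Omega> det R])
qed

end
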